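(* Let $f\in G$, $\mathbf{t}=(t_1,\ldots,t_n)\in\mathbb{R}^n$, $\mathbf{z}=(z_1,\ldots,z_n)>\mathbf{0}$ be such that $f$ is continuously differentiable in a neighbourhood of $t_i-t_0$ for all $i\in\{1,\ldots,n\}$ and all $(t_0,y_0,f)\in K_{\mathbf{t},\mathbf{z}}\cap\bigcup_{l=1,\,l\ne i}^n(K_{t_i,z_i}\cap K_{t_l,z_l})$. Let $$D_i^{(f)}=\{t\in\mathbb{R}:(t,y,f)\in I_{\{i\}}(\mathbf{z})\text{ for some }y>0\}$$ and $S_f=\mathbb{R}\times(0,\infty)\times\{f\}$. Then, for $i\in\{1,\ldots,n\}$, as $m\to\infty$, $$\Lambda\big(I^{(m)}_{\{i\}}(\mathbf{z})\cap S_f\big)=2^{-m}\cdot\mathbb{P}_F(\{f\})\cdot z_i^{-2}\int_{D_i^{(f)}}f(t_i-t)\,\mathrm{d}t+o(2^{-m}).$$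
   Context: Let $G$ be a finite set of measurable functions $f:\mathbb{R}\to[0,\infty)$ such that for all $f\in G$, $c>0$ and $t_0\in\mathbb{R}\setminus\{0\}$ the set $\{t\in\mathbb{R}: f(t)=c f(t_0+t),\ f(t)>0\}$ is finite. Let $F$ be a $G$-valued random function with law $\mathbb{P}_F$, $\mathbb{P}_F(\{f\})>0$ for all $f\in G$, and $\mathbb{E}\left(\int_{\mathbb{R}}F(x)\,\mathrm{d}x\right)=1$. On $S=\mathbb{R}\times(0,\infty)\times G$ let $\Lambda$ be the measure with $\Lambda(A\times B\times C)=\mu(A)\,\mathbb{P}_F(C)\int_B u^{-2}\,\mathrm{d}u$, where $\mu$ is Lebesgue measure. With the convention $z/0=\infty$ for $z>0$: $K_{t,z}=\{(x,y,g)\in S: y=z/g(t-x)\}$, $K_{\mathbf{t},\mathbf{z}}=\{(x,y,g)\in S: y=\min_{i=1,\ldots,n}z_i/g(t_i-x)\}$, and $I_{\{i\}}(\mathbf{z})=\{(x,y,g)\in S: y g(t_i-x)=z_i,\ y g(t_j-x)<z_j,\ j\ne i\}$. For $z>0$, $m\in\mathbb{N}$, let $j_m(z)\in\mathbb{N}\cup\{0\}$ be such that $z\in A_m(z):=(2^{-m}j_m(z),2^{-m}(j_m(z)+1)]$. Let $K^{(m)}_{t_i,z_i}=\{(x,y,g)\in S: y g(t_i-x)\in A_m(z_i)\}$, $K^{(m)}_{\mathbf{t},\mathbf{z}}=\{(x,y,g)\in S: y g(t_i-x)\le2^{-m}(j_m(z_i)+1)\text{ for all }i,\ y g(t_i-x)\in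 A_m(z_i)\text{ for some }i\}$, and $I^{(m)}_{\{i\}}(\mathbf{z})=K^{(m)}_{\mathbf{t},\mathbf{z}}\cap\big(K^{(m)}_{t_i,z_i}\setminus\bigcup_{j\ne i}K^{(m)}_{t_j,z_j}\big)$. *)

theory Defs
  imports "HOL-Analysis.Analysis" "HOL-Probability.Probability" "HOL-Library.Landau_Symbols"
begin

definition finite_scaled_coincidences :: "(real \<Rightarrow> real) \<Rightarrow> bool" where
  "finite_scaled_coincidences f \<longleftrightarrow>
     (\<forall>c>0. \<forall>t0. t0 \<noteq> 0 \<longrightarrow> finite {t. f t = c * f (t0 + t) \<and> f t > 0})"

text \<open>The \<sigma>-algebra on the finite set \<open>G\<close> is the power set.\<close>

definition law :: "(real \<Rightarrow> real) set \<Rightarrow> 'w measure \<Rightarrow> ('w \<Rightarrow> real \<Rightarrow> real) \<Rightarrow> (real \<Rightarrow> real) measure" where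
  "law G M F = distr M (count_space G) F"

definition S_space :: "(real \<Rightarrow> real) set \<Rightarrow> (real \<times> real \<times> (real \<Rightarrow> real)) set" where
  "S_space G = UNIV \<times> {0<..} \<times> G"

definition inv_square_measure :: "real measure" where
  "inv_square_measure = density (restrict_space lborel {0<..}) (\<lambda>u. ennreal (1 / u\<^sup>2))"

definition Lambda ::
  "(real \<Rightarrow> real) set \<Rightarrow> 'w measure \<Rightarrow> ('w \<Rightarrow> real \<Rightarrow> real) \<Rightarrow> (real \<times> real \<times> (real \<Rightarrow> real)) measure" where
  "Lambda G M F = lborel \<Otimes>\<^sub>M (inv_square_measure \<Otimes>\<^sub>M law G M F)"

text \<open>Quotients \<open>z / g (t - x)\<close> are formed in the extended reals, where \<open>z / 0 = \<infinity>\<close> for \<open>z > 0\<close>;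
  in the reals, \<open>z / 0 = 0\<close> would falsify the minimum below.\<close>

definition K_single :: "(real \<Rightarrow> real) set \<Rightarrow> real \<Rightarrow> real \<Rightarrow> (real \<times> real \<times> (real \<Rightarrow> real)) set" where
  "K_single G t z = {(x, y, g) \<in> S_space G. ereal y = ereal z / ereal (g (t - x))}"

definition K_vec ::
  "(real \<Rightarrow> real) set \<Rightarrow> real^'n \<Rightarrow> real^'n \<Rightarrow> (real \<times> real \<times> (real \<Rightarrow> real)) set" where
  "K_vec G t z =
     {(x, y, g) \<in> S_space G. ereal y = Min (range (\<lambda>i. ereal (z $ i) / ereal (g (t $ i - x))))}"

definition I_single ::
  "(real \<Rightarrow> real) set \<Rightarrow> real^'n \<Rightarrow> real^'n \<Rightarrow> 'n \<Rightarrow> (real \<times> real \<times> (real \<Rightarrow> real)) set" where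
  "I_single G t z i =
     {(x, y, g) \<in> S_space G. y * g (t $ i - x) = z $ i \<and> (\<forall>j. j \<noteq> i \<longrightarrow> y * g (t $ j - x) < z $ j)}"

definition dyadic_interval :: "nat \<Rightarrow> nat \<Rightarrow> real set" where
  "dyadic_interval m k = {real k / 2 ^ m <.. (real k + 1) / 2 ^ m}"

definition j_index :: "nat \<Rightarrow> real \<Rightarrow> nat" where
  "j_index m z = (THE k. z \<in> dyadic_interval m k)"

definition A_disc :: "nat \<Rightarrow> real \<Rightarrow> real set" where
  "A_disc m z = dyadic_interval m (j_index m z)"

definition K_disc :: "(real \<Rightarrow> real) set \<Rightarrow> nat \<Rightarrow> real \<Rightarrow> real \<Rightarrow> (real \<times> real \<times> (real \<Rightarrow> real)) set" where
  "K_disc G m t z = {(x, y, g) \<in> S_space G. y * g (t - x) \<in> A_disc m z}"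

definition K_vec_disc ::
  "(real \<Rightarrow> real) set \<Rightarrow> nat \<Rightarrow> real^'n \<Rightarrow> real^'n \<Rightarrow> (real \<times> real \<times> (real \<Rightarrow> real)) set" where
  "K_vec_disc G m t z =
     {(x, y, g) \<in> S_space G.
        (\<forall>i. y * g (t $ i - x) \<le> (real (j_index m (z $ i)) + 1) / 2 ^ m) \<and>
        (\<exists>i. y * g (t $ i - x) \<in> A_disc m (z $ i))}"

definition I_single_disc ::
  "(real \<Rightarrow> real) set \<Rightarrow> nat \<Rightarrow> real^'n \<Rightarrow> real^'n \<Rightarrow> 'n \<Rightarrow> (real \<times> real \<times> (real \<Rightarrow> real)) set" where
  "I_single_disc G m t z i =
     K_vec_disc G m t z \<inter>
       (K_disc G m (t $ i) (z $ i) - (\<Union>j\<in>UNIV - {i}. K_disc G m (t $ j) (z $ j)))"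

definition D_set ::
  "(real \<Rightarrow> real) set \<Rightarrow> real^'n \<Rightarrow> real^'n \<Rightarrow> 'n \<Rightarrow> (real \<Rightarrow> real) \<Rightarrow> real set" where
  "D_set G t z i f = {s. \<exists>y>0. (s, y, f) \<in> I_single G t z i}"

definition C1_near :: "(real \<Rightarrow> real) \<Rightarrow> real \<Rightarrow> bool" where
  "C1_near f s \<longleftrightarrow> (\<exists>U. open U \<and> s \<in> U \<and> f C1_differentiable_on U)"

lemma dyadic_interval_ex1:
  assumes "z > 0"
  shows "\<exists>!k. z \<in> dyadic_interval m k"
proof -
  have iff: "z \<in> dyadic_interval m k \<longleftrightarrow> int k = \<lceil>2 ^ m * z\<rceil> - 1" for k
  proof -
    have "z \<in> dyadic_interval m k \<longleftrightarrow> real k < 2 ^ m * z \<and> 2 ^ m * z \<le> real k + 1"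
      by (auto simp: dyadic_interval_def field_simps)
    also have "\<dots> \<longleftrightarrow> int k = \<lceil>2 ^ m * z\<rceil> - 1"
      by linarith
    finally show ?thesis .
  qed
  have "2 ^ m * z > 0"
    using assms by simp
  then have "\<lceil>2 ^ m * z\<rceil> \<ge> 1"
    by linarith
  then have "int (nat (\<lceil>2 ^ m * z\<rceil> - 1)) = \<lceil>2 ^ m * z\<rceil> - 1"
    by simp
  then show ?thesis
    unfolding iff by (metis of_nat_eq_iff)
qed

lemma mem_A_disc:
  assumes "z > 0"
  shows "z \<in> A_disc m z"
  unfolding A_disc_def j_index_def by (rule theI'[OF dyadic_interval_ex1[OF assms]])

lemma sigma_finite_inv_square_measure: "sigma_finite_measure inv_square_measure"
proof -
  have "sigma_finite_measure (restrict_space lborel ({0<..} :: real set))"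
    by (intro sigma_finite_measure_restrict_space sigma_finite_lborel) simp
  then show ?thesis
    unfolding inv_square_measure_def
    by (subst sigma_finite_measure.sigma_finite_iff_density_finite)
      (auto intro!: measurable_restrict_space1)
qed

lemma emeasure_Lambda_Times:
  assumes "prob_space M" "F \<in> measurable M (count_space G)"
    and X: "X \<in> sets borel" and B: "B \<in> sets borel" "B \<subseteq> {0<..}" and C: "C \<subseteq> G"
  shows "emeasure (Lambda G M F) (X \<times> B \<times> C) =
    emeasure lborel X * emeasure (law G M F) C * (\<integral>\<^sup>+u\<in>B. ennreal (1 / u\<^sup>2) \<partial>lborel)"
proof -
  have "prob_space (law G M F)"
    unfolding law_def using assms(1,2) by (rule prob_space.prob_space_distr)
  then interpret L: prob_space "law G M F" .
  interpret N: sigma_finite_measure inv_square_measure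
    by (rule sigma_finite_inv_square_measure)
  have C': "C \<in> sets (law G M F)"
    using C by (simp add: law_def)
  have B': "B \<in> sets (restrict_space lborel {0<..})"
    using B by (simp add: sets_restrict_space_iff)
  then have B'': "B \<in> sets inv_square_measure"
    by (simp add: inv_square_measure_def)
  have ind: "indicator {0<..} u * (indicator B u * c) = indicator B u * (c :: ennreal)" for u c
    using B(2) by (auto simp: indicator_def)
  have "emeasure inv_square_measure B =
      (\<integral>\<^sup>+u. ennreal (1 / u\<^sup>2) * indicator B u \<partial>restrict_space lborel {0<..})"
    unfolding inv_square_measure_def using B'
    by (intro emeasure_density measurable_restrict_space1) simp_all
  also have "\<dots> = (\<integral>\<^sup>+u\<in>B. ennreal (1 / u\<^sup>2) \<partial>lborel)"
    by (subst nn_integral_restrict_space) (simp_all add: mult.commute ind)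
  finally have "emeasure inv_square_measure B = (\<integral>\<^sup>+u\<in>B. ennreal (1 / u\<^sup>2) \<partial>lborel)" .
  moreover have "sigma_finite_measure (inv_square_measure \<Otimes>\<^sub>M law G M F)"
    by (rule sigma_finite_pair_measure) unfold_locales
  moreover have "B \<times> C \<in> sets (inv_square_measure \<Otimes>\<^sub>M law G M F)"
    using B'' C' by simp
  ultimately show ?thesis
    unfolding Lambda_def using X B'' C'
    by (simp add: sigma_finite_measure.emeasure_pair_measure_Times
        L.emeasure_pair_measure_Times mult_ac)
qed

end

theory Submission
  imports Defs
begin

text \<open>
  Write \<open>u\<^sub>k = f (t\<^sub>k - x)\<close> and let \<open>a\<^sub>k < z\<^sub>k \<le> b\<^sub>k\<close> be the endpoints of the dyadic interval of
  length \<open>h = 2\<^sup>-\<^sup>m\<close> around \<open>z\<^sub>k\<close>. Over a fixed location \<open>x\<close>, the discretised set consists of the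
  heights \<open>y\<close> with \<open>a\<^sub>i < y u\<^sub>i \<le> b\<^sub>i\<close> and \<open>y u\<^sub>j \<le> a\<^sub>j\<close> for all \<open>j \<noteq> i\<close>. By Tonelli, its
  \<open>\<Lambda>\<close>-measure is the probability of \<open>f\<close> times the integral over \<open>x\<close> of the \<open>y\<^sup>-\<^sup>2\<close>-measure of this
  slice, and the claim is that this integral divided by \<open>h\<close> converges.

  The slice is empty if \<open>u\<^sub>i = 0\<close>. Otherwise it lies in the interval from \<open>a\<^sub>i / u\<^sub>i\<close> to
  \<open>b\<^sub>i / u\<^sub>i\<close>, whose \<open>y\<^sup>-\<^sup>2\<close>-measure is exactly \<open>h u\<^sub>i / (a\<^sub>i b\<^sub>i)\<close> as soon as \<open>a\<^sub>i > 0\<close>.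
  For large \<open>m\<close> this is at most \<open>h\<close> times a fixed multiple of \<open>f (t\<^sub>i - x)\<close>,
  which is integrable in \<open>x\<close> because \<open>f\<close> has positive probability and the expected integral is
  finite (\<open>integrable_of_positive_probability\<close>). So dominated convergence applies, and only the
  pointwise limit for \<open>u\<^sub>i > 0\<close> is left (\<open>measure_height_slice_tendsto\<close>, \<open>finite_ties\<close>).

  \<^item> If \<open>u\<^sub>j / z\<^sub>j < u\<^sub>i / z\<^sub>i\<close> for all \<open>j \<noteq> i\<close>, that is, if \<open>x\<close> is in the domain \<open>D\<close> of
    integration, then the constraints from \<open>j \<noteq> i\<close> eventually hold on the whole interval, and the
    quotient tends to \<open>u\<^sub>i / z\<^sub>i\<^sup>2\<close>.
  \<^item> If \<open>u\<^sub>j / z\<^sub>j > u\<^sub>i / z\<^sub>i\<close> for some \<open>j\<close>, the slice is eventually empty.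
  \<^item> A tie \<open>u\<^sub>j / z\<^sub>j = u\<^sub>i / z\<^sub>i > 0\<close> with \<open>t\<^sub>i \<noteq> t\<^sub>j\<close> occurs only for finitely many \<open>x\<close>, by the
    assumption on scaled coincidences of \<open>f\<close>. A tie with \<open>t\<^sub>i = t\<^sub>j\<close> forces \<open>z\<^sub>i = z\<^sub>j\<close>; then the
    constraints \<open>y u\<^sub>i > a\<^sub>i\<close> and \<open>y u\<^sub>j \<le> a\<^sub>j\<close> contradict each other, and the slice is empty.
\<close>

section \<open>The inverse square measure\<close>

lemma sets_inv_square_measure: "sets inv_square_measure = sets (restrict_space borel {0<..})"
  by (simp add: inv_square_measure_def sets_restrict_space)

lemma space_inv_square_measure: "space inv_square_measure = {0<..}"
  by (simp add: inv_square_measure_def space_restrict_space)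

lemma measurable_ident_inv_square_measure: "(\<lambda>y. y) \<in> borel_measurable inv_square_measure"
proof -
  have "(\<lambda>y. y) \<in> borel_measurable (restrict_space borel ({0<..} :: real set))"
    by (intro measurable_restrict_space1) simp
  then show ?thesis
    by (simp add: measurable_cong_sets[OF sets_inv_square_measure refl])
qed

lemma emeasure_inv_square_measure:
  assumes "B \<in> sets borel" "B \<subseteq> {0<..}"
  shows "emeasure inv_square_measure B = (\<integral>\<^sup>+u\<in>B. ennreal (1 / u\<^sup>2) \<partial>lborel)"
proof -
  have B: "B \<in> sets (restrict_space lborel {0<..})"
    using assms by (simp add: sets_restrict_space_iff)
  have ind: "indicator {0<..} u * (indicator B u * c) = indicator B u * (c :: ennreal)" for u c
    using assms(2) by (auto simp: indicator_def)
  have "emeasure inv_square_measure B =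
      (\<integral>\<^sup>+u. ennreal (1 / u\<^sup>2) * indicator B u \<partial>restrict_space lborel {0<..})"
    unfolding inv_square_measure_def using B
    by (intro emeasure_density measurable_restrict_space1) simp_all
  also have "\<dots> = (\<integral>\<^sup>+u\<in>B. ennreal (1 / u\<^sup>2) \<partial>lborel)"
    by (subst nn_integral_restrict_space) (simp_all add: mult.commute ind)
  finally show ?thesis .
qed

lemma emeasure_inv_square_measure_Ioc:
  assumes "0 < c" "c \<le> d"
  shows "emeasure inv_square_measure {c<..d} = ennreal (1 / c - 1 / d)"
proof -
  have "emeasure inv_square_measure {c<..d} =
      (\<integral>\<^sup>+u. ennreal (1 / u\<^sup>2) * indicator {c<..d} u \<partial>lborel)"
    using assms by (intro emeasure_inv_square_measure) auto
  also have "\<dots> = (\<integral>\<^sup>+u. ennreal (1 / u\<^sup>2) * indicator {c..d} u \<partial>lborel)"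
    using AE_lborel_singleton[of c]
    by (intro nn_integral_cong_AE) (auto simp: indicator_def)
  also have "\<dots> = ennreal (- 1 / d - (- 1 / c))"
    using assms
    by (intro nn_integral_FTC_Icc[where F = "\<lambda>u. - 1 / u"])
      (auto intro!: derivative_eq_intros simp: power2_eq_square)
  finally show ?thesis by simp
qed

section \<open>Slices of the discretised set over a fixed location\<close>

definition height_slice ::
  "('n \<Rightarrow> real) \<Rightarrow> ('n \<Rightarrow> real) \<Rightarrow> ('n \<Rightarrow> real) \<Rightarrow> 'n \<Rightarrow> real set" where
  "height_slice u a b i =
     {y. 0 < y \<and> y * u i \<in> {a i<..b i} \<and> (\<forall>j. j \<noteq> i \<longrightarrow> y * u j \<le> a j)}"

lemma height_slice_borel [measurable]:
  fixes u :: "'n :: finite \<Rightarrow> real"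
  shows "height_slice u a b i \<in> sets borel"
  unfolding height_slice_def by measurable

lemma height_slice_subset:
  assumes "0 \<le> u i" "0 \<le> a i"
  shows "height_slice u a b i \<subseteq> (if u i = 0 then {} else {a i / u i<..b i / u i})"
  using assms by (auto simp: height_slice_def field_simps)

lemma emeasure_height_slice_le:
  fixes u :: "'n :: finite \<Rightarrow> real"
  assumes "0 \<le> u i" "0 < a i" "a i < b i"
  shows "emeasure inv_square_measure (height_slice u a b i)
    \<le> ennreal (u i * (b i - a i) / (a i * b i))"
proof (cases "u i = 0")
  case True
  then show ?thesis
    using height_slice_subset[of u i a b] assms by simp
next
  case False
  with assms have u: "u i > 0" by simp
  have "emeasure inv_square_measure (height_slice u a b i)
      \<le> emeasure inv_square_measure {a i / u i<..b i / u i}"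
  proof (rule emeasure_mono)
    show "height_slice u a b i \<subseteq> {a i / u i<..b i / u i}"
      using height_slice_subset[of u i a b] assms u by simp
    have "{a i / u i<..b i / u i} \<subseteq> {0<..}"
      using assms u by (auto intro: less_trans[OF divide_pos_pos])
    then show "{a i / u i<..b i / u i} \<in> sets inv_square_measure"
      by (simp add: sets_inv_square_measure sets_restrict_space_iff)
  qed
  also have "\<dots> = ennreal (1 / (a i / u i) - 1 / (b i / u i))"
    using assms u by (intro emeasure_inv_square_measure_Ioc) (auto simp: divide_simps)
  also have "1 / (a i / u i) - 1 / (b i / u i) = u i * (b i - a i) / (a i * b i)"
    using assms u by (simp add: field_simps)
  finally show ?thesis .
qed

lemma measure_height_slice_le:
  fixes u :: "'n :: finite \<Rightarrow> real"
  assumes "0 \<le> u i" "0 < a i" "a i < b i"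
  shows "measure inv_square_measure (height_slice u a b i) \<le> u i * (b i - a i) / (a i * b i)"
  unfolding measure_def using emeasure_height_slice_le[of u i a b] assms
  by (auto intro!: enn2real_leI)

lemma measure_height_slice_eq:
  fixes u :: "'n :: finite \<Rightarrow> real"
  assumes "0 < u i" "0 < a i" "a i < b i" "\<And>j. 0 \<le> u j"
    and slack: "\<And>j. j \<noteq> i \<Longrightarrow> b i * u j \<le> a j * u i"
  shows "measure inv_square_measure (height_slice u a b i) = u i * (b i - a i) / (a i * b i)"
proof -
  have "height_slice u a b i = {a i / u i<..b i / u i}"
  proof (intro equalityI)
    show "height_slice u a b i \<subseteq> {a i / u i<..b i / u i}"
      using height_slice_subset[of u i a b] assms by simp
    have "y * u j \<le> a j" if "j \<noteq> i" "y \<le> b i / u i" for y j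
    proof -
      have "y * u j \<le> b i / u i * u j"
        using that assms by (intro mult_right_mono) auto
      also have "\<dots> \<le> a j"
        using slack[OF that(1)] assms by (simp add: field_simps)
      finally show ?thesis .
    qed
    moreover have "0 < y" if "a i / u i < y" for y
      using that assms by (auto intro: less_trans[OF divide_pos_pos])
    ultimately show "{a i / u i<..b i / u i} \<subseteq> height_slice u a b i"
      using assms by (auto simp: height_slice_def field_simps)
  qed
  then have "emeasure inv_square_measure (height_slice u a b i)
      = ennreal (1 / (a i / u i) - 1 / (b i / u i))"
    using assms by (simp add: emeasure_inv_square_measure_Ioc divide_right_mono)
  also have "1 / (a i / u i) - 1 / (b i / u i) = u i * (b i - a i) / (a i * b i)"
    using assms by (simp add: field_simps)
  finally show ?thesis
    using assms by (simp add: measure_def)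
qed

text \<open>A bound for \<open>j\<close> at or below the lower end of the interval for \<open>i\<close>. Positivity of \<open>u j\<close> matters:
  for \<open>u j = 0\<close> and \<open>a j = 0\<close> the index \<open>j\<close> imposes no constraint.\<close>

lemma height_slice_empty:
  assumes "0 < u i" "0 < u j" "j \<noteq> i" "a j * u i \<le> a i * u j"
  shows "height_slice u a b i = {}"
proof -
  have False if "a i < y * u i" "y * u j \<le> a j" for y
  proof -
    have "y * u j * u i \<le> a j * u i"
      using that assms by simp
    also have "\<dots> \<le> a i * u j"
      by fact
    also have "\<dots> < y * u i * u j"
      using that assms by simp
    finally show False
      by (simp add: mult_ac)
  qed
  then show ?thesis
    using assms by (auto simp: height_slice_def)
qed

text \<open>The case distinction at the heart of the proof. The hypothesis \<open>tie\<close> restricts the limiting ties to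
  those that are already present at every finite stage, so that the slices there are empty.\<close>

lemma measure_height_slice_tendsto:
  fixes u z :: "'n :: finite \<Rightarrow> real" and a b :: "nat \<Rightarrow> 'n \<Rightarrow> real" and h :: "nat \<Rightarrow> real"
  assumes u: "\<And>k. 0 \<le> u k" and z: "\<And>k. 0 < z k"
    and a: "\<And>k. (\<lambda>m. a m k) \<longlonglongrightarrow> z k" and b: "(\<lambda>m. b m i) \<longlonglongrightarrow> z i"
    and h: "\<And>m. b m i = a m i + h m" "\<And>m. 0 < h m"
    and tie: "\<And>j m. j \<noteq> i \<Longrightarrow> 0 < u i \<Longrightarrow> u j * z i = u i * z j \<Longrightarrow> a m j * u i \<le> a m i * u j"
  shows "(\<lambda>m. measure inv_square_measure (height_slice u (a m) (b m) i) / h m) \<longlonglongrightarrow>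
    (if 0 < u i \<and> (\<forall>j. j \<noteq> i \<longrightarrow> u j * z i < u i * z j) then u i / (z i)\<^sup>2 else 0)"
    (is "?q \<longlonglongrightarrow> _")
proof -
  have a_pos: "\<forall>\<^sub>F m in sequentially. 0 < a m i"
    using a z by (intro order_tendstoD) auto
  consider (zero) "u i = 0"
    | (inside) "0 < u i" "\<And>j. j \<noteq> i \<Longrightarrow> u j * z i < u i * z j"
    | (outside) j where "0 < u i" "j \<noteq> i" "u i * z j < u j * z i"
    | (tied) j where "0 < u i" "j \<noteq> i" "u j * z i = u i * z j"
    using u[of i] by (metis less_eq_real_def linorder_less_linear)
  then show ?thesis
  proof cases
    case zero
    from a_pos have "\<forall>\<^sub>F m in sequentially. ?q m = 0"
      by eventually_elim (use height_slice_subset[of u i] zero in simp)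
    then show ?thesis
      using zero by (simp add: tendsto_eventually)
  next
    case inside
    have "\<forall>\<^sub>F m in sequentially. b m i * u j < a m j * u i" if "j \<noteq> i" for j
    proof -
      have "(\<lambda>m. a m j * u i - b m i * u j) \<longlonglongrightarrow> z j * u i - z i * u j"
        by (intro tendsto_intros a b)
      then have "\<forall>\<^sub>F m in sequentially. 0 < a m j * u i - b m i * u j"
        by (rule order_tendstoD) (use inside(2)[OF that] in \<open>simp add: mult_ac\<close>)
      then show ?thesis by simp
    qed
    then have "\<forall>\<^sub>F m in sequentially. \<forall>j. j \<noteq> i \<longrightarrow> b m i * u j < a m j * u i"
      by (intro eventually_all_finite) auto
    with a_pos have "\<forall>\<^sub>F m in sequentially. ?q m = u i / (a m i * b m i)"
    proof eventually_elim
      case (elim m)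
      have "measure inv_square_measure (height_slice u (a m) (b m) i)
          = u i * (b m i - a m i) / (a m i * b m i)"
        using elim inside h(1)[of m] h(2)[of m] u
        by (intro measure_height_slice_eq) (auto intro: less_imp_le)
      then show ?case
        using h(1)[of m] h(2)[of m] by simp
    qed
    moreover have "(\<lambda>m. u i / (a m i * b m i)) \<longlonglongrightarrow> u i / (z i * z i)"
      using z[of i] by (intro tendsto_intros a b) auto
    ultimately have "?q \<longlonglongrightarrow> u i / (z i * z i)"
      by (simp add: tendsto_cong)
    then show ?thesis
      using inside by (simp add: power2_eq_square)
  next
    case outside
    have "0 < u i * z j"
      using outside z by simp
    with outside(3) have "0 < u j * z i" by linarith
    then have uj: "0 < u j"
      using z[of i] by (simp add: zero_less_mult_iff)
    have "(\<lambda>m. a m i * u j - a m j * u i) \<longlonglongrightarrow> z i * u j - z j * u i"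
      by (intro tendsto_intros a)
    then have "\<forall>\<^sub>F m in sequentially. 0 < a m i * u j - a m j * u i"
      by (rule order_tendstoD) (use outside in \<open>simp add: mult_ac\<close>)
    then have "\<forall>\<^sub>F m in sequentially. ?q m = 0"
      by eventually_elim (use height_slice_empty[of u i j] outside uj in simp)
    then show ?thesis
      using outside by (auto simp: tendsto_eventually dest: spec[of _ j])
  next
    case tied
    have "0 < u i * z j"
      using tied z by simp
    with tied(3) have "0 < u j * z i" by linarith
    then have uj: "0 < u j"
      using z[of i] by (simp add: zero_less_mult_iff)
    have "?q m = 0" for m
      using height_slice_empty[of u i j "a m"] tied uj tie[of j m] by simp
    then have "?q = (\<lambda>_. 0)" by blast
    then show ?thesis
      using tied by auto
  qed
qed

section \<open>Fibres of the intensity measure over a single function\<close>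

lemma emeasure_Lambda_fibre:
  assumes "prob_space M" "F \<in> measurable M (count_space G)" "f \<in> G"
    and E: "E \<in> sets (lborel \<Otimes>\<^sub>M inv_square_measure)"
  shows "emeasure (Lambda G M F) {(x, y, g). (x, y) \<in> E \<and> g = f} =
    (\<integral>\<^sup>+x. emeasure inv_square_measure (Pair x -` E) \<partial>lborel) * emeasure (law G M F) {f}"
proof -
  have "prob_space (law G M F)"
    unfolding law_def using assms(1,2) by (rule prob_space.prob_space_distr)
  then interpret L: prob_space "law G M F" .
  interpret N: sigma_finite_measure inv_square_measure
    by (rule sigma_finite_inv_square_measure)
  interpret NL: sigma_finite_measure "inv_square_measure \<Otimes>\<^sub>M law G M F"
    by (rule sigma_finite_pair_measure) unfold_locales
  have f: "{f} \<in> sets (law G M F)" "space (law G M F) = G"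
    using assms(3) by (simp_all add: law_def)
  let ?\<phi> = "\<lambda>w. ((fst w, fst (snd w)), snd (snd w))"
  have "?\<phi> -` (E \<times> {f}) \<inter> space (Lambda G M F) \<in> sets (Lambda G M F)"
    unfolding Lambda_def using E f
    by (intro measurable_sets[where A = "(lborel \<Otimes>\<^sub>M inv_square_measure) \<Otimes>\<^sub>M law G M F"]) auto
  also have "?\<phi> -` (E \<times> {f}) \<inter> space (Lambda G M F) = {(x, y, g). (x, y) \<in> E \<and> g = f}"
    using sets.sets_into_space[OF E] assms(3) f(2)
    by (auto simp: Lambda_def space_pair_measure)
  finally have meas: "{(x, y, g). (x, y) \<in> E \<and> g = f} \<in> sets (Lambda G M F)" .
  have "emeasure (Lambda G M F) {(x, y, g). (x, y) \<in> E \<and> g = f} =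
      (\<integral>\<^sup>+x. emeasure (inv_square_measure \<Otimes>\<^sub>M law G M F)
        (Pair x -` {(x, y, g). (x, y) \<in> E \<and> g = f}) \<partial>lborel)"
    using meas unfolding Lambda_def by (rule NL.emeasure_pair_measure_alt)
  also have "\<dots> = (\<integral>\<^sup>+x. emeasure inv_square_measure (Pair x -` E) *
      emeasure (law G M F) {f} \<partial>lborel)"
  proof (rule nn_integral_cong)
    fix x
    have "Pair x -` {(x, y, g). (x, y) \<in> E \<and> g = f} = (Pair x -` E) \<times> {f}"
      by auto
    then show "emeasure (inv_square_measure \<Otimes>\<^sub>M law G M F)
        (Pair x -` {(x, y, g). (x, y) \<in> E \<and> g = f}) =
      emeasure inv_square_measure (Pair x -` E) * emeasure (law G M F) {f}"
      using sets_Pair1[OF E, of x] f by (simp add: L.emeasure_pair_measure_Times)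
  qed
  also have "\<dots> = (\<integral>\<^sup>+x. emeasure inv_square_measure (Pair x -` E) \<partial>lborel) *
      emeasure (law G M F) {f}"
    using N.measurable_emeasure_Pair[OF E] by (intro nn_integral_multc) simp
  finally show ?thesis .
qed

text \<open>The event that the random function equals \<open>f\<close> alone contributes the probability of \<open>f\<close> times
  the integral of \<open>f\<close> to the expected integral.\<close>

lemma integrable_of_positive_probability:
  assumes "f \<in> borel_measurable borel" "\<And>x. f x \<ge> 0"
    and F: "F \<in> measurable M (count_space G)"
    and pos: "measure (law G M F) {f} > 0"
    and mean: "(\<integral>\<^sup>+\<omega>. (\<integral>\<^sup>+x. ennreal (F \<omega> x) \<partial>lborel) \<partial>M) < \<infinity>"
    and f: "f \<in> G"
  shows "integrable lborel f"
proof -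
  let ?N = "\<lambda>g. \<integral>\<^sup>+x. ennreal (g x) \<partial>lborel"
  have "?N f * emeasure (law G M F) {f} = (\<integral>\<^sup>+g. ?N f * indicator {f} g \<partial>law G M F)"
    using f by (simp add: law_def nn_integral_cmult_indicator)
  also have "\<dots> \<le> (\<integral>\<^sup>+g. ?N g \<partial>law G M F)"
    by (intro nn_integral_mono) (auto simp: indicator_def)
  also have "\<dots> = (\<integral>\<^sup>+\<omega>. ?N (F \<omega>) \<partial>M)"
    unfolding law_def using F by (intro nn_integral_distr) auto
  finally have "?N f * emeasure (law G M F) {f} < \<infinity>"
    using mean by (rule le_less_trans)
  moreover have "emeasure (law G M F) {f} \<noteq> 0"
    using pos by (auto simp: measure_def)
  ultimately have "?N f < \<infinity>"
    by (auto simp: ennreal_mult_less_top top.not_eq_extremum less_top)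
  then show ?thesis
    using assms(1,2) by (intro integrableI_nonneg) auto
qed

section \<open>The asymptotic expansion\<close>

lemma A_disc_bounds:
  assumes "z > 0"
  shows "real (j_index m z) / 2 ^ m < z" "z \<le> (real (j_index m z) + 1) / 2 ^ m"
  using mem_A_disc[OF assms, of m] by (simp_all add: A_disc_def dyadic_interval_def)

lemma I_single_disc_fibre:
  assumes "f \<in> G"
  shows "I_single_disc G m t z i \<inter> (UNIV \<times> {0<..} \<times> {f}) =
    {(x, y, g). y \<in> height_slice (\<lambda>k. f (t $ k - x)) (\<lambda>k. real (j_index m (z $ k)) / 2 ^ m)
        (\<lambda>k. (real (j_index m (z $ k)) + 1) / 2 ^ m) i \<and> g = f}" (is "?L = ?R")
proof -
  have step: "real k / 2 ^ m < (real k + 1) / 2 ^ m" for k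
    by (simp add: divide_strict_right_mono)
  have "(x, y, g) \<in> ?L \<longleftrightarrow> (x, y, g) \<in> ?R" for x y g
  proof -
    let ?lo = "\<lambda>k. real (j_index m (z $ k)) / 2 ^ m"
    let ?hi = "\<lambda>k. (real (j_index m (z $ k)) + 1) / 2 ^ m"
    have "(x, y, g) \<in> ?L \<longleftrightarrow> g = f \<and> 0 < y \<and> (\<forall>k. y * f (t $ k - x) \<le> ?hi k) \<and>
        y * f (t $ i - x) \<in> A_disc m (z $ i) \<and>
        (\<forall>j. j \<noteq> i \<longrightarrow> y * f (t $ j - x) \<notin> A_disc m (z $ j))"
      using assms unfolding I_single_disc_def K_vec_disc_def K_disc_def S_space_def by auto
    also have "\<dots> \<longleftrightarrow> g = f \<and> 0 < y \<and> y * f (t $ i - x) \<in> {?lo i<..?hi i} \<and>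
        (\<forall>j. j \<noteq> i \<longrightarrow> y * f (t $ j - x) \<le> ?lo j)"
    proof -
      have "y * f (t $ j - x) \<le> ?hi j \<and> y * f (t $ j - x) \<notin> A_disc m (z $ j) \<longleftrightarrow>
          y * f (t $ j - x) \<le> ?lo j" for j
        using step[of "j_index m (z $ j)"] by (auto simp: A_disc_def dyadic_interval_def)
      moreover have "A_disc m (z $ i) = {?lo i<..?hi i}"
        by (simp add: A_disc_def dyadic_interval_def)
      ultimately show ?thesis
        by (metis greaterThanAtMost_iff)
    qed
    also have "\<dots> \<longleftrightarrow> (x, y, g) \<in> ?R"
      by (auto simp: height_slice_def)
    finally show ?thesis .
  qed
  then show ?thesis by auto
qed

lemma D_set_iff:
  assumes "f \<in> G" "\<And>x. 0 \<le> f x" "\<And>k. 0 < z $ k"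
  shows "s \<in> D_set G t z i f \<longleftrightarrow> 0 < f (t $ i - s) \<and>
    (\<forall>j. j \<noteq> i \<longrightarrow> f (t $ j - s) * z $ i < f (t $ i - s) * z $ j)" (is "_ \<longleftrightarrow> ?R")
proof
  assume "s \<in> D_set G t z i f"
  then obtain y where y: "y > 0" "y * f (t $ i - s) = z $ i"
      "\<And>j. j \<noteq> i \<Longrightarrow> y * f (t $ j - s) < z $ j"
    by (auto simp: D_set_def I_single_def)
  have fi: "0 < f (t $ i - s)"
    using y(1,2) assms(3)[of i] by (metis zero_less_mult_pos)
  moreover have "f (t $ j - s) * z $ i < f (t $ i - s) * z $ j" if "j \<noteq> i" for j
    using mult_strict_right_mono[OF y(3)[OF that] fi] by (simp add: y(2)[symmetric] mult_ac)
  ultimately show ?R by blast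
next
  assume R: ?R
  then show "s \<in> D_set G t z i f"
    using assms unfolding D_set_def I_single_def S_space_def
    by (auto intro!: exI[of _ "z $ i / f (t $ i - s)"] simp: field_simps)
qed

text \<open>Ties with \<open>t\<^sub>j = t\<^sub>i\<close> and \<open>z\<^sub>j = z\<^sub>i\<close> may fill a set of positive measure, so they are left out
  here. If \<open>t\<^sub>j \<noteq> t\<^sub>i\<close>, a tie is a scaled coincidence of \<open>f\<close> with shift \<open>t\<^sub>j - t\<^sub>i\<close> and factor
  \<open>z\<^sub>i / z\<^sub>j\<close>; if \<open>t\<^sub>j = t\<^sub>i\<close>, cancelling the common positive value gives \<open>z\<^sub>j = z\<^sub>i\<close>.\<close>

lemma finite_ties:
  fixes t z :: "real^'n"
  assumes "finite_scaled_coincidences f" "\<And>k. 0 < z $ k"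
  shows "finite {x. 0 < f (t $ i - x) \<and> f (t $ j - x) * z $ i = f (t $ i - x) * z $ j \<and>
    \<not> (t $ j = t $ i \<and> z $ j = z $ i)}" (is "finite ?T")
proof (cases "t $ j = t $ i")
  case True
  then have "?T = {}" by auto
  then show ?thesis by (simp only: finite.emptyI)
next
  case False
  let ?c = "z $ i / z $ j" and ?d = "t $ j - t $ i"
  let ?C = "{s. f s = ?c * f (?d + s) \<and> f s > 0}"
  have "0 < ?c" "?d \<noteq> 0"
    using assms(2) False by auto
  then have "finite ?C"
    using assms(1) unfolding finite_scaled_coincidences_def by blast
  moreover have "?T \<subseteq> (\<lambda>s. t $ i - s) ` ?C"
  proof
    fix x assume x: "x \<in> ?T"
    then have "t $ i - x \<in> ?C"
      using assms(2)[of j] by (auto simp: field_simps)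
    then have "t $ i - (t $ i - x) \<in> (\<lambda>s. t $ i - s) ` ?C"
      by (rule imageI)
    then show "x \<in> (\<lambda>s. t $ i - s) ` ?C" by simp
  qed
  ultimately show ?thesis
    by (meson finite_imageI finite_subset)
qed

theorem proposition5:
  fixes G :: "(real \<Rightarrow> real) set"
    and M :: "'w measure"
    and F :: "'w \<Rightarrow> real \<Rightarrow> real"
    and f :: "real \<Rightarrow> real"
    and t z :: "real^'n"
    and i :: 'n
  assumes "finite G"
    and "\<And>g. g \<in> G \<Longrightarrow> g \<in> borel_measurable borel"
    and "\<And>g x. g \<in> G \<Longrightarrow> g x \<ge> 0"
    and "\<And>g. g \<in> G \<Longrightarrow> finite_scaled_coincidences g"
    and "prob_space M"
    and "F \<in> measurable M (count_space G)"
    and "\<And>g. g \<in> G \<Longrightarrow> measure (law G M F) {g} > 0"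
    and "(\<integral>\<^sup>+\<omega>. (\<integral>\<^sup>+x. ennreal (F \<omega> x) \<partial>lborel) \<partial>M) = 1"
    and "f \<in> G"
    and "\<And>k. z $ k > 0"
    and "\<And>k t0 y0. (t0, y0, f) \<in> K_vec G t z \<inter>
           (\<Union>l\<in>UNIV - {k}. K_single G (t $ k) (z $ k) \<inter> K_single G (t $ l) (z $ l)) \<Longrightarrow>
         C1_near f (t $ k - t0)"
  shows "(\<forall>\<^sub>F m in sequentially.
            emeasure (Lambda G M F) (I_single_disc G m t z i \<inter> (UNIV \<times> {0<..} \<times> {f})) < \<infinity>) \<and>
         (\<lambda>m. measure (Lambda G M F) (I_single_disc G m t z i \<inter> (UNIV \<times> {0<..} \<times> {f})) -
            1 / 2 ^ m * measure (law G M F) {f} * (1 / (z $ i)\<^sup>2) *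
              (LINT s:D_set G t z i f|lborel. f (t $ i - s)))
         \<in> o(\<lambda>m. 1 / 2 ^ m)"
proof -
  interpret N: sigma_finite_measure inv_square_measure
    by (rule sigma_finite_inv_square_measure)
  have f_meas [measurable]: "f \<in> borel_measurable borel" and f_nonneg: "\<And>x. 0 \<le> f x"
    using assms(2,3,9) by auto
  have z: "\<And>k. 0 < z $ k" by fact
  have "prob_space (law G M F)"
    unfolding law_def using assms(5,6) by (rule prob_space.prob_space_distr)
  then interpret L: prob_space "law G M F" .

  define p where "p = measure (law G M F) {f}"
  define u where "u x k = f (t $ k - x)" for x k
  define h :: "nat \<Rightarrow> real" where "h m = 1 / 2 ^ m" for m
  define a where "a m k = real (j_index m (z $ k)) / 2 ^ m" for m k
  define b where "b m k = (real (j_index m (z $ k)) + 1) / 2 ^ m" for m k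
  define Y where "Y m x = height_slice (u x) (a m) (b m) i" for m x
  define V where "V m x = measure inv_square_measure (Y m x)" for m x
  define D where "D = D_set G t z i f"

  have h_pos: "0 < h m" and b_eq: "b m k = a m k + h m" for m k
    by (simp_all add: h_def a_def b_def add_divide_distrib)
  have az: "a m k < z $ k" and zb: "z $ k \<le> b m k" for m k
    using A_disc_bounds[OF z] by (simp_all add: a_def b_def)
  have h_lim: "h \<longlonglongrightarrow> 0"
    unfolding h_def using LIMSEQ_inverse_realpow_zero[of 2] by (simp add: inverse_eq_divide)
  have a_lim: "(\<lambda>m. a m k) \<longlonglongrightarrow> z $ k" for k
  proof (rule tendsto_sandwich[of "\<lambda>m. z $ k - h m" _ _ "\<lambda>_. z $ k"])
    show "(\<lambda>m. z $ k - h m) \<longlonglongrightarrow> z $ k"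
      using tendsto_diff[OF tendsto_const h_lim] by simp
    show "\<forall>\<^sub>F m in sequentially. z $ k - h m \<le> a m k"
      using zb[of k] b_eq by (auto simp: algebra_simps)
    show "\<forall>\<^sub>F m in sequentially. a m k \<le> z $ k"
      using az by (intro always_eventually allI less_imp_le)
  qed simp
  have b_lim: "(\<lambda>m. b m k) \<longlonglongrightarrow> z $ k" for k
    unfolding b_eq using tendsto_add[OF a_lim h_lim] by simp

  have u_int: "integrable lborel (\<lambda>x. u x i)"
  proof -
    have "integrable lborel f"
      using assms by (intro integrable_of_positive_probability[of f F M G]) auto
    then show ?thesis
      using lborel_integrable_real_affine[of f "-1" "t $ i"] by (simp add: u_def)
  qed
  have u_meas [measurable]: "(\<lambda>x. u x k) \<in> borel_measurable borel" for k
    unfolding u_def by measurable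
  have u_nonneg: "0 \<le> u x k" for x k
    by (simp add: u_def f_nonneg)

  define E where "E m = {(x, y). y \<in> Y m x}" for m
  have E_meas: "E m \<in> sets (lborel \<Otimes>\<^sub>M inv_square_measure)" for m
  proof -
    note [measurable] = measurable_ident_inv_square_measure
    have "{w \<in> space (lborel \<Otimes>\<^sub>M inv_square_measure).
        a m i < snd w * u (fst w) i \<and> snd w * u (fst w) i \<le> b m i \<and>
        (\<forall>j. j \<noteq> i \<longrightarrow> snd w * u (fst w) j \<le> a m j)} \<in> sets (lborel \<Otimes>\<^sub>M inv_square_measure)"
      by measurable
    also have "{w \<in> space (lborel \<Otimes>\<^sub>M inv_square_measure).
        a m i < snd w * u (fst w) i \<and> snd w * u (fst w) i \<le> b m i \<and>
        (\<forall>j. j \<noteq> i \<longrightarrow> snd w * u (fst w) j \<le> a m j)} = E m"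
      by (auto simp: E_def Y_def height_slice_def space_pair_measure space_inv_square_measure)
    finally show ?thesis .
  qed
  have Y_E: "Pair x -` E m = Y m x" for m x
    by (auto simp: E_def)
  have V_meas [measurable]: "V m \<in> borel_measurable lborel" for m
    unfolding V_def measure_def using N.measurable_emeasure_Pair[OF E_meas[of m]]
    by (simp add: Y_E)
  have \<Lambda>_eq: "emeasure (Lambda G M F) (I_single_disc G m t z i \<inter> (UNIV \<times> {0<..} \<times> {f})) =
      (\<integral>\<^sup>+x. emeasure inv_square_measure (Y m x) \<partial>lborel) * ennreal p" for m
  proof -
    have "I_single_disc G m t z i \<inter> (UNIV \<times> {0<..} \<times> {f}) = {(x, y, g). (x, y) \<in> E m \<and> g = f}"
      unfolding I_single_disc_fibre[OF assms(9)]
      by (simp add: E_def Y_def u_def[abs_def] a_def[abs_def] b_def[abs_def])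
    then show ?thesis
      using emeasure_Lambda_fibre[OF assms(5,6,9) E_meas[of m]]
      by (simp add: Y_E p_def L.emeasure_eq_measure)
  qed

  \<comment> \<open>From some stage on, \<open>a\<^sub>i > z\<^sub>i / 2\<close>, while always \<open>b\<^sub>i \<ge> z\<^sub>i\<close>. So \<open>h u\<^sub>i / (a\<^sub>i b\<^sub>i)\<close> is at most
    \<open>h\<close> times \<open>2 u\<^sub>i / z\<^sub>i\<^sup>2\<close>, which is the dominating function. It also keeps the measures finite;
    while \<open>a\<^sub>i = 0\<close>, a slice may reach down to height \<open>0\<close> and have infinite measure.\<close>
  obtain m0 where m0: "\<And>m. m \<ge> m0 \<Longrightarrow> z $ i / 2 < a m i"
    using order_tendstoD(1)[OF a_lim[of i], of "z $ i / 2"] z[of i]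
    by (auto simp: eventually_sequentially)
  define c where "c = 2 / (z $ i)\<^sup>2"
  have dom: "emeasure inv_square_measure (Y m x) \<le> ennreal (h m * (c * u x i))"
    and V_dom: "V m x \<le> h m * (c * u x i)" if "m \<ge> m0" for m x
  proof -
    have a_pos: "0 < a m i" "a m i < b m i"
      using m0[OF that] z[of i] h_pos[of m] b_eq[of m i] by auto
    have "(z $ i)\<^sup>2 / 2 = z $ i / 2 * z $ i"
      by (simp add: power2_eq_square)
    also have "\<dots> \<le> a m i * b m i"
      using m0[OF that] zb[of i m] z[of i] by (intro mult_mono) auto
    finally have "u x i * h m / (a m i * b m i) \<le> u x i * h m / ((z $ i)\<^sup>2 / 2)"
      using u_nonneg[of x i] h_pos[of m] z[of i] a_pos by (intro divide_left_mono) auto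
    then have le: "u x i * (b m i - a m i) / (a m i * b m i) \<le> h m * (c * u x i)"
      by (simp add: b_eq c_def mult_ac)
    show "emeasure inv_square_measure (Y m x) \<le> ennreal (h m * (c * u x i))"
      unfolding Y_def
      using emeasure_height_slice_le[of "u x" i "a m" "b m"] a_pos u_nonneg ennreal_leI[OF le]
      by (meson order_trans)
    show "V m x \<le> h m * (c * u x i)"
      unfolding Y_def V_def
      using measure_height_slice_le[of "u x" i "a m" "b m"] a_pos u_nonneg le
      by (meson order_trans)
  qed
  have c_int: "integrable lborel (\<lambda>x. c * u x i)"
    using u_int by simp
  have V_int: "integrable lborel (V m)" if "m \<ge> m0" for m
  proof (rule Bochner_Integration.integrable_bound)
    show "integrable lborel (\<lambda>x. h m * (c * u x i))"
      using c_int by simp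
    show "AE x in lborel. norm (V m x) \<le> norm (h m * (c * u x i))"
      using V_dom[OF that] by (intro AE_I2) (simp add: V_def order_trans[OF _ abs_ge_self])
  qed simp
  have V_nonneg: "0 \<le> V m x" for m x
    by (simp add: V_def)
  have \<Lambda>_V: "emeasure (Lambda G M F) (I_single_disc G m t z i \<inter> (UNIV \<times> {0<..} \<times> {f})) =
      ennreal (p * (LINT x|lborel. V m x))" if "m \<ge> m0" for m
  proof -
    have "emeasure inv_square_measure (Y m x) = ennreal (V m x)" for x
      unfolding V_def using dom[OF that, of x]
      by (intro emeasure_eq_ennreal_measure) (auto simp: top_unique)
    then have "(\<integral>\<^sup>+x. emeasure inv_square_measure (Y m x) \<partial>lborel) =
        ennreal (LINT x|lborel. V m x)"
      using V_int[OF that] V_nonneg by (simp add: nn_integral_eq_integral)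
    then show ?thesis
      unfolding \<Lambda>_eq by (simp add: p_def ennreal_mult'' mult.commute)
  qed

  define g where "g x = indicator D x * u x i / (z $ i)\<^sup>2" for x
  have D_iff: "s \<in> D \<longleftrightarrow> 0 < u s i \<and> (\<forall>j. j \<noteq> i \<longrightarrow> u s j * z $ i < u s i * z $ j)" for s
    unfolding D_def u_def using assms(9) f_nonneg z by (rule D_set_iff)
  have "D = {s. 0 < u s i \<and> (\<forall>j. j \<noteq> i \<longrightarrow> u s j * z $ i < u s i * z $ j)}"
    using D_iff by blast
  also have "\<dots> \<in> sets borel"
    by measurable
  finally have [measurable]: "D \<in> sets borel" .
  have pointwise: "AE x in lborel. (\<lambda>m. V m x / h m) \<longlonglongrightarrow> g x"
  proof (rule AE_I')
    let ?T = "\<Union>j. {x. 0 < f (t $ i - x) \<and> f (t $ j - x) * z $ i = f (t $ i - x) * z $ j \<and>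
      \<not> (t $ j = t $ i \<and> z $ j = z $ i)}"
    have "finite ?T"
      using assms(4,9) z by (intro finite_UN_I finite_ties) auto
    then show "?T \<in> null_sets lborel"
      by (rule finite_imp_null_set_lborel)
    have "(\<lambda>m. V m x / h m) \<longlonglongrightarrow> g x" if "x \<notin> ?T" for x
    proof -
      have "(\<lambda>m. measure inv_square_measure (height_slice (u x) (a m) (b m) i) / h m) \<longlonglongrightarrow>
        (if 0 < u x i \<and> (\<forall>j. j \<noteq> i \<longrightarrow> u x j * z $ i < u x i * z $ j)
         then u x i / (z $ i)\<^sup>2 else 0)"
      proof (rule measure_height_slice_tendsto)
        fix j m assume tie: "0 < u x i" "u x j * z $ i = u x i * z $ j"
        with that have "t $ j = t $ i \<and> z $ j = z $ i"
          by (auto simp: u_def)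
        then show "a m j * u x i \<le> a m i * u x j"
          by (simp add: a_def u_def)
      qed (use u_nonneg z a_lim b_lim b_eq h_pos in auto)
      moreover have "(if 0 < u x i \<and> (\<forall>j. j \<noteq> i \<longrightarrow> u x j * z $ i < u x i * z $ j)
          then u x i / (z $ i)\<^sup>2 else 0) = g x"
        unfolding g_def indicator_def D_iff by auto
      ultimately show ?thesis
        unfolding V_def Y_def by (simp only:)
    qed
    then show "{x \<in> space lborel. \<not> (\<lambda>m. V m x / h m) \<longlonglongrightarrow> g x} \<subseteq> ?T"
      by blast
  qed
  have "(\<lambda>m. LINT x|lborel. V (m + m0) x / h (m + m0)) \<longlonglongrightarrow> (LINT x|lborel. g x)"
  proof (rule integral_dominated_convergence[where w = "\<lambda>x. c * u x i"])
    show "AE x in lborel. (\<lambda>m. V (m + m0) x / h (m + m0)) \<longlonglongrightarrow> g x"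
      using pointwise by eventually_elim (rule LIMSEQ_ignore_initial_segment)
    show "AE x in lborel. norm (V (m + m0) x / h (m + m0)) \<le> c * u x i" for m
      using V_dom[of "m + m0"] h_pos[of "m + m0"]
      by (intro AE_I2) (simp add: V_def divide_le_eq mult_ac)
    show "g \<in> borel_measurable lborel"
      unfolding g_def[abs_def] by measurable
  qed (use c_int in simp_all)
  then have V_lim: "(\<lambda>m. (LINT x|lborel. V m x) / h m) \<longlonglongrightarrow> (LINT x|lborel. g x)"
    by - (rule LIMSEQ_offset[where k = m0 and f = "\<lambda>m. (LINT x|lborel. V m x) / h m"], simp)

  let ?R = "\<lambda>m. measure (Lambda G M F) (I_single_disc G m t z i \<inter> (UNIV \<times> {0<..} \<times> {f})) -
    1 / 2 ^ m * measure (law G M F) {f} * (1 / (z $ i)\<^sup>2) *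
      (LINT s:D_set G t z i f|lborel. f (t $ i - s))"
  have g_int: "(LINT x|lborel. g x) =
      1 / (z $ i)\<^sup>2 * (LINT s:D_set G t z i f|lborel. f (t $ i - s))"
    by (simp add: g_def[abs_def] set_lebesgue_integral_def u_def D_def)
  have R_eq: "?R m / h m = p * ((LINT x|lborel. V m x) / h m - (LINT x|lborel. g x))"
    if "m \<ge> m0" for m
  proof -
    have "0 \<le> p * (LINT x|lborel. V m x)"
      by (intro mult_nonneg_nonneg integral_nonneg_AE) (auto simp: p_def V_def)
    then have "measure (Lambda G M F) (I_single_disc G m t z i \<inter> (UNIV \<times> {0<..} \<times> {f})) =
        p * (LINT x|lborel. V m x)"
      using \<Lambda>_V[OF that] by (simp add: measure_def)
    then show ?thesis
      unfolding g_int p_def[symmetric] h_def by (simp add: field_simps)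
  qed
  have "(\<lambda>m. ?R m / h m) \<longlonglongrightarrow> 0"
  proof (rule Lim_transform_eventually)
    show "(\<lambda>m. p * ((LINT x|lborel. V m x) / h m - (LINT x|lborel. g x))) \<longlonglongrightarrow> 0"
      by (rule tendsto_mult_right_zero[OF LIM_zero[OF V_lim]])
    show "\<forall>\<^sub>F m in sequentially.
        p * ((LINT x|lborel. V m x) / h m - (LINT x|lborel. g x)) = ?R m / h m"
      using eventually_ge_at_top[of m0] by eventually_elim (rule R_eq[symmetric])
  qed
  moreover have h_nz: "h m \<noteq> 0" for m
    using h_pos[of m] by simp
  ultimately have "?R \<in> o(h)"
    by (intro smalloI_tendsto always_eventually allI) (simp_all add: h_nz)
  moreover have "\<forall>\<^sub>F m in sequentially.
      emeasure (Lambda G M F) (I_single_disc G m t z i \<inter> (UNIV \<times> {0<..} \<times> {f})) < \<infinity>"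
    using eventually_ge_at_top[of m0] by eventually_elim (simp add: \<Lambda>_V)
  ultimately show ?thesis
    by (simp add: h_def[abs_def])
qed

end
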